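(* Let $(X,p)$ be a quasi-normed cone and let $Y$ be a subcone of $X$ such that $G_Y$ is closed with respect to $\mathcal{T}(d_p)$, i.e. $\overline{G_Y}^{d_p}=G_Y$. Then the polar $Y^0=\{f\in X^* : f|_{G_Y}\equiv 0\}$ is a subcone of $X^*$ which is isometrically isomorphic to $(X/Y)^*$.
   Context: $\mathbb{R}^+$ is the set of nonnegative real numbers. A cone (on $\mathbb{R}^+$) is a triple $(X,+,\cdot)$ such that $(X,+)$ is an abelian monoid with neutral element $0$ and $\cdot:\mathbb{R}^+\times X\to X$ satisfies, for all $x,y\in X$ and $r,s\in\mathbb{R}^+$: $r\cdot(s\cdot x)=(rs)\cdot x$; $r\cdot(x+y)=r\cdot x+r\cdot y$; $(r+s)\cdot x=r\cdot x+s\cdot x$; $1\cdot x=x$; $0\cdot x=0$. It is cancellative if $z+x=z+y$ implies $x=y$. A subcone of $X$ is a subset which is a cone under the restricted operations. A linear mapping between cones is a mapping $f$ with $f(\alpha\cdot x+\beta\cdot y)=\alpha\cdot f(x)+\beta\cdot f(y)$ for all $x,y$ and $\alpha,\beta\in\mathbb{R}^+$. $-x$ denotes the additive inverse of $x$ when it exists. A quasi-norm on a cone $X$ is a function $q:X\to\mathbb{R}^+$ such that for all $x,y\in X$, $r\in\mathbb{R}^+$: (i) $x=0$ if and only if there is $-x\in X$ and $q(x)=q(-x)=0$; (ii) $q(r\cdot x)=rq(x)$; (iii) $q(x+y)\le q(x)+q(y)$. A quasi-normed cone is a pair $(X,p)$ where $X$ is a cancellative cone and $p$ is a quasi-norm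 on $X$. Its induced extended quasi-metric is $d_p(x,y)=p(a)$ if $y=x+a$ with $a\in X$, and $d_p(x,y)=+\infty$ if $y\notin x+X$. $\mathcal{T}(d_p)$ is the topology on $X$ with base the balls $B_{d_p}(x,r)=\{y\in X: d_p(x,y)<r\}$, $x\in X$, $r>0$; $\overline{A}^{d_p}$ is the closure of $A$ in $\mathcal{T}(d_p)$. A mapping between quasi-normed cones $(X,p)$ and $(Z,q)$ is continuous if it is continuous from $\mathcal{T}(d_p)$ to $\mathcal{T}(d_q)$. For a subcone $Y$ of $X$, $G_Y=\{y\in Y: -y\in Y\}$, $[x]=\{x+g: g\in G_Y\}$, and $X/Y=\{[x]: x\in X\}$ is the quotient cone with operations $[x]+[z]=[x+z]$, $\lambda\cdot[x]=[\lambda\cdot x]$ ($\lambda\in\mathbb{R}^+$). When $G_Y$ is closed in $(X,\mathcal{T}(d_p))$, $X/Y$ is a quasi-normed cone with the quasi-norm $\hat p([x])=\inf\{p(x+y): y\in G_Y\}$. Let $u(t)=\max\{t,0\}$, a quasi-norm on $\mathbb{R}$. The dual cone $X^*$ of $(X,p)$ is the cone, under pointwise operations, of all continuous linear mappings from $(X,p)$ to $(\mathbb{R},u)$, equipped with the quasi-norm $\|f\|_{p,u}=\sup\{u(f(x)): x\in X,\ p(x)\le 1\}$. Likewise $(X/Y)^*$ is the dual cone of $(X/Y,\hat p)$ with the quasi-norm $\|\cdot\|_{\hat p,u}$; $Y^0$ carries the restriction of $\|\cdot\|_{p,u}$. Two quasi-normed cones $(A,a)$, $(B,b)$ are isometrically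 isomorphic if there is a bijective continuous linear mapping $T:A\to B$ with $T^{-1}$ continuous and $b(T(x))=a(x)$ for all $x\in A$. *)

theory Defs
  imports
    "HOL-Algebra.Coset"
    "HOL-Analysis.Abstract_Topology"
    "HOL-Library.Extended_Real"
begin

section \<open>Cones on the nonnegative reals\<close>

text \<open>The additive monoid of a cone is a HOL-Algebra \<^locale>\<open>comm_monoid\<close>, so the sum is written
  \<open>x \<otimes> y\<close>, the neutral element \<open>\<one>\<close>, and the additive inverse, which exists exactly for the
  elements of \<^const>\<open>Units\<close>, is \<open>inv x\<close>. The scalar action is only constrained at nonnegative
  reals.\<close>

record 'a rcone = "'a monoid" +
  scale :: "real \<Rightarrow> 'a \<Rightarrow> 'a"  (infixr \<open>\<odot>\<index>\<close> 75)

locale rcone = comm_monoid X for X :: "'a rcone" (structure) +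
  assumes scale_closed [simp, intro]: "\<lbrakk>0 \<le> r; x \<in> carrier X\<rbrakk> \<Longrightarrow> r \<odot> x \<in> carrier X"
    and scale_scale: "\<lbrakk>0 \<le> r; 0 \<le> s; x \<in> carrier X\<rbrakk> \<Longrightarrow> r \<odot> (s \<odot> x) = (r * s) \<odot> x"
    and scale_add: "\<lbrakk>0 \<le> r; x \<in> carrier X; y \<in> carrier X\<rbrakk> \<Longrightarrow> r \<odot> (x \<otimes> y) = r \<odot> x \<otimes> r \<odot> y"
    and add_scale: "\<lbrakk>0 \<le> r; 0 \<le> s; x \<in> carrier X\<rbrakk> \<Longrightarrow> (r + s) \<odot> x = r \<odot> x \<otimes> s \<odot> x"
    and one_scale [simp]: "x \<in> carrier X \<Longrightarrow> 1 \<odot> x = x"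
    and zero_scale [simp]: "x \<in> carrier X \<Longrightarrow> 0 \<odot> x = \<one>"

definition subcone :: "'a set \<Rightarrow> 'a rcone \<Rightarrow> bool" where
  "subcone Y X \<longleftrightarrow> rcone X \<and> Y \<subseteq> carrier X \<and> rcone (X\<lparr>carrier := Y\<rparr>)"

definition linear_map :: "'a rcone \<Rightarrow> 'b rcone \<Rightarrow> ('a \<Rightarrow> 'b) \<Rightarrow> bool" where
  "linear_map X Z f \<longleftrightarrow> f \<in> carrier X \<rightarrow> carrier Z \<and>
     (\<forall>x\<in>carrier X. \<forall>y\<in>carrier X. \<forall>\<alpha>\<ge>0. \<forall>\<beta>\<ge>0.
        f (\<alpha> \<odot>\<^bsub>X\<^esub> x \<otimes>\<^bsub>X\<^esub> \<beta> \<odot>\<^bsub>X\<^esub> y) = \<alpha> \<odot>\<^bsub>Z\<^esub> f x \<otimes>\<^bsub>Z\<^esub> \<beta> \<odot>\<^bsub>Z\<^esub> f y)"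


section \<open>Quasi-normed cones and their topology\<close>

definition quasi_norm :: "'a rcone \<Rightarrow> ('a \<Rightarrow> real) \<Rightarrow> bool" where
  "quasi_norm X q \<longleftrightarrow>
     (\<forall>x\<in>carrier X. 0 \<le> q x) \<and>
     (\<forall>x\<in>carrier X. x = \<one>\<^bsub>X\<^esub> \<longleftrightarrow> x \<in> Units X \<and> q x = 0 \<and> q (inv\<^bsub>X\<^esub> x) = 0) \<and>
     (\<forall>x\<in>carrier X. \<forall>r\<ge>0. q (r \<odot>\<^bsub>X\<^esub> x) = r * q x) \<and>
     (\<forall>x\<in>carrier X. \<forall>y\<in>carrier X. q (x \<otimes>\<^bsub>X\<^esub> y) \<le> q x + q y)"

locale quasi_normed_cone = rcone X for X :: "'a rcone" (structure) and p :: "'a \<Rightarrow> real" +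
  assumes cancel: "\<lbrakk>x \<in> carrier X; y \<in> carrier X; z \<in> carrier X; z \<otimes> x = z \<otimes> y\<rbrakk> \<Longrightarrow> x = y"
    and quasi_norm: "quasi_norm X p"

text \<open>The element \<open>a\<close> with \<open>y = x + a\<close> is unique in a cancellative cone.\<close>

definition qdist :: "'a rcone \<Rightarrow> ('a \<Rightarrow> real) \<Rightarrow> 'a \<Rightarrow> 'a \<Rightarrow> ereal" where
  "qdist X p x y =
     (if \<exists>a\<in>carrier X. y = x \<otimes>\<^bsub>X\<^esub> a
      then ereal (p (THE a. a \<in> carrier X \<and> y = x \<otimes>\<^bsub>X\<^esub> a)) else \<infinity>)"

definition qball :: "'a rcone \<Rightarrow> ('a \<Rightarrow> real) \<Rightarrow> 'a \<Rightarrow> real \<Rightarrow> 'a set" where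
  "qball X p x r = {y \<in> carrier X. qdist X p x y < ereal r}"

text \<open>The topology with base the balls. That these do form a base is
  \<open>quasi_normed_cone.openin_qtopology\<close> below.\<close>

definition qtopology :: "'a rcone \<Rightarrow> ('a \<Rightarrow> real) \<Rightarrow> 'a topology" where
  "qtopology X p =
     topology (arbitrary union_of (\<lambda>B. \<exists>x\<in>carrier X. \<exists>r>0. B = qball X p x r))"

definition isometrically_isomorphic ::
  "'a rcone \<Rightarrow> ('a \<Rightarrow> real) \<Rightarrow> 'b rcone \<Rightarrow> ('b \<Rightarrow> real) \<Rightarrow> bool" where
  "isometrically_isomorphic A a B b \<longleftrightarrow>
     quasi_normed_cone A a \<and> quasi_normed_cone B b \<and>
     (\<exists>T. bij_betw T (carrier A) (carrier B) \<and> linear_map A B T \<and>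
        continuous_map (qtopology A a) (qtopology B b) T \<and>
        continuous_map (qtopology B b) (qtopology A a) (inv_into (carrier A) T) \<and>
        (\<forall>x\<in>carrier A. b (T x) = a x))"

context quasi_normed_cone
begin

lemma p_nonneg: "x \<in> carrier X \<Longrightarrow> 0 \<le> p x"
  and p_scale: "x \<in> carrier X \<Longrightarrow> 0 \<le> r \<Longrightarrow> p (r \<odot> x) = r * p x"
  and p_add: "x \<in> carrier X \<Longrightarrow> y \<in> carrier X \<Longrightarrow> p (x \<otimes> y) \<le> p x + p y"
  and p_zero: "p \<one> = 0"
  using quasi_norm by (auto simp: quasi_norm_def)

lemma qdist_add:
  assumes "x \<in> carrier X" "a \<in> carrier X"
  shows "qdist X p x (x \<otimes> a) = ereal (p a)"
proof -
  have "(THE b. b \<in> carrier X \<and> x \<otimes> a = x \<otimes> b) = a"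
    using assms cancel by (intro the_equality) auto
  then show ?thesis using assms by (auto simp: qdist_def)
qed

lemma qball_eq:
  assumes "x \<in> carrier X"
  shows "qball X p x r = {x \<otimes> a |a. a \<in> carrier X \<and> p a < r}"
proof -
  have "\<exists>a. y = x \<otimes> a \<and> a \<in> carrier X \<and> p a < r"
    if lt: "qdist X p x y < ereal r" for y
  proof -
    have "\<exists>a\<in>carrier X. y = x \<otimes> a"
      using lt unfolding qdist_def by (rule contrapos_pp) simp
    then obtain a where a: "a \<in> carrier X" "y = x \<otimes> a" by blast
    then have "p a < r" using lt qdist_add[OF assms a(1)] by simp
    with a show ?thesis by blast
  qed
  then show ?thesis
    using assms by (auto simp: qball_def qdist_add)
qed

lemma qball_subset:
  assumes x: "x \<in> carrier X" and y: "y \<in> qball X p x r"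
  shows "\<exists>s>0. qball X p y s \<subseteq> qball X p x r"
proof -
  obtain a where a: "a \<in> carrier X" "y = x \<otimes> a" "p a < r"
    using y qball_eq[OF x] by auto
  have yc: "y \<in> carrier X" using a x by auto
  have "qball X p y (r - p a) \<subseteq> qball X p x r"
  proof
    fix z assume "z \<in> qball X p y (r - p a)"
    then obtain b where b: "b \<in> carrier X" "z = y \<otimes> b" "p b < r - p a"
      using qball_eq[OF yc] by auto
    then have "z = x \<otimes> (a \<otimes> b)" "p (a \<otimes> b) < r"
      using a x p_add[of a b] by (auto simp: m_assoc)
    then show "z \<in> qball X p x r"
      using a b qball_eq[OF x] by auto
  qed
  then show ?thesis using a(3) by (intro exI[of _ "r - p a"]) auto
qed

lemma centre_in_qball: "x \<in> carrier X \<Longrightarrow> 0 < r \<Longrightarrow> x \<in> qball X p x r"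
  by (auto simp: qball_eq p_zero intro!: exI[of _ \<one>])

lemma union_of_qballs_iff:
  "(arbitrary union_of (\<lambda>B. \<exists>x\<in>carrier X. \<exists>r>0. B = qball X p x r)) U \<longleftrightarrow>
     U \<subseteq> carrier X \<and> (\<forall>x\<in>U. \<exists>r>0. qball X p x r \<subseteq> U)" (is "?L \<longleftrightarrow> ?R")
proof
  assume L: ?L
  have *: "\<exists>c\<in>carrier X. \<exists>s>0. x \<in> qball X p c s \<and> qball X p c s \<subseteq> U" if "x \<in> U" for x
    using L that unfolding arbitrary_union_of_alt by blast
  show ?R
  proof (intro conjI subsetI ballI)
    fix x assume "x \<in> U"
    then show "x \<in> carrier X" using * by (fastforce simp: qball_def)
  next
    fix x assume "x \<in> U"
    then show "\<exists>r>0. qball X p x r \<subseteq> U" using * qball_subset by (meson order_trans)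
  qed
next
  assume R: ?R
  show ?L unfolding arbitrary_union_of_alt
  proof
    fix x assume "x \<in> U"
    with R obtain r where "x \<in> carrier X" "r > 0" "qball X p x r \<subseteq> U" by blast
    with centre_in_qball show
      "\<exists>B. (\<exists>x\<in>carrier X. \<exists>r>0. B = qball X p x r) \<and> x \<in> B \<and> B \<subseteq> U" by blast
  qed
qed

lemma openin_qtopology_iff:
  "openin (qtopology X p) U \<longleftrightarrow> U \<subseteq> carrier X \<and> (\<forall>x\<in>U. \<exists>r>0. qball X p x r \<subseteq> U)"
  and openin_qtopology: "openin (qtopology X p) =
     arbitrary union_of (\<lambda>B. \<exists>x\<in>carrier X. \<exists>r>0. B = qball X p x r)"
proof -
  have "istopology (\<lambda>U. U \<subseteq> carrier X \<and> (\<forall>x\<in>U. \<exists>r>0. qball X p x r \<subseteq> U))"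
    unfolding istopology_def
  proof (intro conjI allI impI)
    fix S T
    assume S: "S \<subseteq> carrier X \<and> (\<forall>x\<in>S. \<exists>r>0. qball X p x r \<subseteq> S)"
      and T: "T \<subseteq> carrier X \<and> (\<forall>x\<in>T. \<exists>r>0. qball X p x r \<subseteq> T)"
    show "S \<inter> T \<subseteq> carrier X" using S by blast
    show "\<forall>x\<in>S \<inter> T. \<exists>r>0. qball X p x r \<subseteq> S \<inter> T"
    proof
      fix x assume "x \<in> S \<inter> T"
      then obtain r s where rs: "r > 0" "s > 0" "qball X p x r \<subseteq> S" "qball X p x s \<subseteq> T"
        using S T by blast
      have "qball X p x (min r s) \<subseteq> qball X p x r \<inter> qball X p x s"
        by (auto simp: qball_def less_le_trans)
      then show "\<exists>r>0. qball X p x r \<subseteq> S \<inter> T"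
        using rs by (intro exI[of _ "min r s"]) auto
    qed
  qed (meson Sup_least UnionE Union_upper order_trans)+
  then have "istopology (arbitrary union_of (\<lambda>B. \<exists>x\<in>carrier X. \<exists>r>0. B = qball X p x r))"
    unfolding union_of_qballs_iff[abs_def] .
  then show "openin (qtopology X p) =
     arbitrary union_of (\<lambda>B. \<exists>x\<in>carrier X. \<exists>r>0. B = qball X p x r)"
    by (simp add: qtopology_def)
  then show "openin (qtopology X p) U \<longleftrightarrow> U \<subseteq> carrier X \<and> (\<forall>x\<in>U. \<exists>r>0. qball X p x r \<subseteq> U)"
    by (simp add: union_of_qballs_iff)
qed

lemma topspace_qtopology: "topspace (qtopology X p) = carrier X"
proof -
  have "openin (qtopology X p) (carrier X)"
    by (auto simp: openin_qtopology_iff qball_def intro: exI[of _ 1])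
  then show ?thesis
    using openin_qtopology_iff openin_topspace openin_subset by (metis subset_antisym)
qed

end


section \<open>The quotient cone\<close>

definition invertibles :: "'a rcone \<Rightarrow> 'a set \<Rightarrow> 'a set" where
  "invertibles X Y = {y \<in> Y. y \<in> Units X \<and> inv\<^bsub>X\<^esub> y \<in> Y}"

abbreviation coset :: "'a rcone \<Rightarrow> 'a set \<Rightarrow> 'a \<Rightarrow> 'a set" where
  "coset X Y x \<equiv> x <#\<^bsub>X\<^esub> invertibles X Y"

text \<open>The operations are those induced from representatives; see \<open>quotient_add\<close> and
  \<open>quotient_scale\<close> below for \<open>[x] + [z] = [x + z]\<close> and \<open>\<lambda> \<cdot> [x] = [\<lambda> \<cdot> x]\<close>. The union is over equal
  sets. (The elementwise product \<open>{\<lambda> \<cdot> x' | x' \<in> [x]}\<close> would be wrong for \<open>\<lambda> = 0\<close>.)\<close>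

definition quotient_cone :: "'a rcone \<Rightarrow> 'a set \<Rightarrow> 'a set rcone" where
  "quotient_cone X Y =
     \<lparr>carrier = coset X Y ` carrier X,
      monoid.mult = (\<lambda>A B. \<Union>x\<in>A. \<Union>z\<in>B. coset X Y (x \<otimes>\<^bsub>X\<^esub> z)),
      one = coset X Y \<one>\<^bsub>X\<^esub>,
      scale = (\<lambda>r A. \<Union>x\<in>A. coset X Y (r \<odot>\<^bsub>X\<^esub> x))\<rparr>"

text \<open>Since \<open>[x] = {x + y | y \<in> G\<^sub>Y}\<close>, this is \<open>[x] \<mapsto> inf {p (x + y) | y \<in> G\<^sub>Y}\<close>.\<close>

definition quotient_norm :: "('a \<Rightarrow> real) \<Rightarrow> 'a set \<Rightarrow> real" where
  "quotient_norm p A = (INF x\<in>A. p x)"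

lemma quotient_norm_coset:
  "quotient_norm p (coset X Y x) = (INF y\<in>invertibles X Y. p (x \<otimes>\<^bsub>X\<^esub> y))"
proof -
  have "coset X Y x = (\<lambda>y. x \<otimes>\<^bsub>X\<^esub> y) ` invertibles X Y"
    by (auto simp: l_coset_def)
  then show ?thesis by (simp add: quotient_norm_def image_image)
qed

context
  fixes X :: "'a rcone" (structure) and Y
  assumes sub: "subcone Y X"
begin

interpretation rcone X using sub by (simp add: subcone_def)

lemma invertibles_carrier: "g \<in> invertibles X Y \<Longrightarrow> g \<in> carrier X"
  by (auto simp: invertibles_def)

lemma subcone_one: "\<one> \<in> Y"
  and subcone_add: "x \<in> Y \<Longrightarrow> y \<in> Y \<Longrightarrow> x \<otimes> y \<in> Y"
  and subcone_scale: "x \<in> Y \<Longrightarrow> 0 \<le> r \<Longrightarrow> r \<odot> x \<in> Y"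
proof -
  interpret Y: rcone "X\<lparr>carrier := Y\<rparr>" using sub by (simp add: subcone_def)
  show "\<one> \<in> Y" using Y.one_closed by simp
  show "x \<in> Y \<Longrightarrow> y \<in> Y \<Longrightarrow> x \<otimes> y \<in> Y" using Y.m_closed[of x y] by simp
  show "x \<in> Y \<Longrightarrow> 0 \<le> r \<Longrightarrow> r \<odot> x \<in> Y" using Y.scale_closed[of r x] by simp
qed

lemma exchange:
  assumes "a \<in> carrier X" "b \<in> carrier X" "c \<in> carrier X" "d \<in> carrier X"
  shows "a \<otimes> b \<otimes> (c \<otimes> d) = a \<otimes> d \<otimes> (b \<otimes> c)"
  using assms by (simp add: m_ac)

lemma invertiblesI:
  assumes "x \<in> Y" "y \<in> Y" "x \<otimes> y = \<one>"
  shows "x \<in> invertibles X Y"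
proof -
  have "x \<in> carrier X" "y \<in> carrier X" using assms sub by (auto simp: subcone_def)
  moreover from this have "inv x = y" using assms m_comm by (metis inv_unique')
  moreover have "y \<otimes> x = \<one>" using calculation assms m_comm by metis
  ultimately show ?thesis using assms by (auto simp: invertibles_def Units_def)
qed

lemma invertibles_inv:
  "g \<in> invertibles X Y \<Longrightarrow> g \<in> Y \<and> inv g \<in> Y \<and> inv g \<in> carrier X \<and> g \<otimes> inv g = \<one>"
  by (auto simp: invertibles_def)

lemma invertibles_one: "\<one> \<in> invertibles X Y"
  by (rule invertiblesI[of _ \<one>]) (auto simp: subcone_one)

lemma invertibles_uminus:
  assumes "g \<in> invertibles X Y"
  shows "inv g \<in> invertibles X Y"
  using invertibles_inv[OF assms] assms invertibles_carrier[OF assms]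
  by (intro invertiblesI[of _ g]) (auto simp: m_comm)

lemma invertibles_add:
  assumes "g \<in> invertibles X Y" "h \<in> invertibles X Y"
  shows "g \<otimes> h \<in> invertibles X Y"
proof (rule invertiblesI[of _ "inv h \<otimes> inv g"])
  note gh = invertibles_inv[OF assms(1)] invertibles_inv[OF assms(2)]
    assms[THEN invertibles_carrier]
  show "g \<otimes> h \<in> Y" "inv h \<otimes> inv g \<in> Y" using gh subcone_add by auto
  have "g \<otimes> h \<otimes> (inv h \<otimes> inv g) = g \<otimes> inv g \<otimes> (h \<otimes> inv h)"
    using gh(1,2) assms[THEN invertibles_carrier] by (intro exchange) auto
  then show "g \<otimes> h \<otimes> (inv h \<otimes> inv g) = \<one>" using gh by simp
qed

lemma scale_one: "0 \<le> r \<Longrightarrow> r \<odot> \<one> = \<one>"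
  using scale_scale[of r 0 \<one>] by simp

lemma invertibles_scale:
  assumes "g \<in> invertibles X Y" "0 \<le> r"
  shows "r \<odot> g \<in> invertibles X Y"
proof (rule invertiblesI[of _ "r \<odot> inv g"])
  note g = invertibles_inv[OF assms(1)] invertibles_carrier[OF assms(1)]
  show "r \<odot> g \<in> Y" "r \<odot> inv g \<in> Y" using g subcone_scale assms by auto
  show "r \<odot> g \<otimes> r \<odot> inv g = \<one>"
    using g assms scale_add[of r g "inv g"] by (simp add: scale_one)
qed

lemma coset_self: "x \<in> carrier X \<Longrightarrow> x \<in> coset X Y x"
  using invertibles_one by (force simp: l_coset_def)

lemma coset_shift:
  assumes x: "x \<in> carrier X" and g: "g \<in> invertibles X Y"
  shows "coset X Y (x \<otimes> g) = coset X Y x"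
proof -
  note gc = invertibles_inv[OF g] invertibles_carrier[OF g] invertibles_carrier
  have 1: "x \<otimes> g \<otimes> h = x \<otimes> (g \<otimes> h)" if "h \<in> invertibles X Y" for h
    using x gc that by (simp add: m_assoc)
  have 2: "x \<otimes> h = x \<otimes> g \<otimes> (inv g \<otimes> h)" if h: "h \<in> invertibles X Y" for h
  proof -
    have hc: "h \<in> carrier X" using h by (rule invertibles_carrier)
    have "x \<otimes> g \<otimes> (inv g \<otimes> h) = x \<otimes> h \<otimes> (g \<otimes> inv g)"
      using x gc(1,2) hc by (intro exchange) auto
    then show ?thesis using x gc hc by simp
  qed
  show ?thesis
    unfolding l_coset_def
    using 1 2 invertibles_add[OF g] invertibles_add[OF invertibles_uminus[OF g]] by fast
qed

lemma in_cosetE: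
  assumes "x' \<in> coset X Y x"
  obtains g where "g \<in> invertibles X Y" "x' = x \<otimes> g"
  using assms by (auto simp: l_coset_def)

lemma quotient_add:
  assumes x: "x \<in> carrier X" and z: "z \<in> carrier X"
  shows "coset X Y x \<otimes>\<^bsub>quotient_cone X Y\<^esub> coset X Y z = coset X Y (x \<otimes> z)"
proof -
  have "coset X Y (x' \<otimes> z') = coset X Y (x \<otimes> z)"
    if x': "x' \<in> coset X Y x" and z': "z' \<in> coset X Y z" for x' z'
  proof -
    obtain g h where gh: "g \<in> invertibles X Y" "x' = x \<otimes> g" "h \<in> invertibles X Y" "z' = z \<otimes> h"
      using x' z' by (elim in_cosetE) iprover
    then have "x' \<otimes> z' = x \<otimes> z \<otimes> (g \<otimes> h)"
      using x z gh(1,3)[THEN invertibles_carrier] by (simp add: m_ac)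
    then show ?thesis using coset_shift[of "x \<otimes> z" "g \<otimes> h"] x z gh invertibles_add by simp
  qed
  then have "(\<Union>x'\<in>coset X Y x. \<Union>z'\<in>coset X Y z. coset X Y (x' \<otimes> z')) = coset X Y (x \<otimes> z)"
    using coset_self[OF x] coset_self[OF z] by blast
  then show ?thesis by (simp add: quotient_cone_def)
qed

lemma quotient_scale:
  assumes x: "x \<in> carrier X" and r: "0 \<le> r"
  shows "r \<odot>\<^bsub>quotient_cone X Y\<^esub> coset X Y x = coset X Y (r \<odot> x)"
proof -
  have "coset X Y (r \<odot> x') = coset X Y (r \<odot> x)" if x': "x' \<in> coset X Y x" for x'
  proof -
    obtain g where g: "g \<in> invertibles X Y" "x' = x \<otimes> g" by (rule in_cosetE[OF x'])
    then have "r \<odot> x' = r \<odot> x \<otimes> r \<odot> g" using x r invertibles_carrier by (simp add: scale_add)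
    then show ?thesis using coset_shift[of "r \<odot> x" "r \<odot> g"] x r g invertibles_scale by simp
  qed
  then have "(\<Union>x'\<in>coset X Y x. coset X Y (r \<odot> x')) = coset X Y (r \<odot> x)"
    using coset_self[OF x] by blast
  then show ?thesis by (simp add: quotient_cone_def)
qed

end


section \<open>The dual cone and polars\<close>

definition real_cone :: "real rcone" where
  "real_cone = \<lparr>carrier = UNIV, monoid.mult = (+), one = 0, scale = (*)\<rparr>"

definition pos_norm :: "real \<Rightarrow> real" where
  "pos_norm t = max t 0"

text \<open>Functionals are normalised to be \<^const>\<open>undefined\<close> outside the carrier, so that equality of
  elements of the dual is equality of mappings on the cone.\<close>

definition dual_cone :: "'a rcone \<Rightarrow> ('a \<Rightarrow> real) \<Rightarrow> ('a \<Rightarrow> real) rcone" where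
  "dual_cone X p =
     \<lparr>carrier = {f \<in> extensional (carrier X). linear_map X real_cone f \<and>
        continuous_map (qtopology X p) (qtopology real_cone pos_norm) f},
      monoid.mult = (\<lambda>f g. \<lambda>x\<in>carrier X. f x + g x),
      one = (\<lambda>x\<in>carrier X. 0),
      scale = (\<lambda>r f. \<lambda>x\<in>carrier X. r * f x)\<rparr>"

definition dual_norm :: "'a rcone \<Rightarrow> ('a \<Rightarrow> real) \<Rightarrow> ('a \<Rightarrow> real) \<Rightarrow> real" where
  "dual_norm X p f = (SUP x\<in>{x \<in> carrier X. p x \<le> 1}. pos_norm (f x))"

definition polar :: "'a rcone \<Rightarrow> ('a \<Rightarrow> real) \<Rightarrow> 'a set \<Rightarrow> ('a \<Rightarrow> real) set" where
  "polar X p Y = {f \<in> carrier (dual_cone X p). \<forall>y\<in>invertibles X Y. f y = 0}"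

lemma quasi_normed_real_cone: "quasi_normed_cone real_cone pos_norm"
proof -
  have comm: "comm_monoid real_cone"
    by unfold_locales (auto simp: real_cone_def)
  then interpret comm_monoid real_cone .
  have "inv\<^bsub>real_cone\<^esub> x = - x" for x
    by (rule sym, rule inv_unique'[THEN sym, symmetric]) (auto simp: real_cone_def)
  moreover have "x \<in> Units real_cone" for x
    by (auto simp: Units_def real_cone_def intro: exI[of _ "- x"])
  ultimately have "quasi_norm real_cone pos_norm"
    by (auto simp: quasi_norm_def real_cone_def pos_norm_def max_def mult_le_0_iff zero_le_mult_iff)
  with comm show ?thesis
    by (auto simp: quasi_normed_cone_def quasi_normed_cone_axioms_def rcone_def rcone_axioms_def)
      (auto simp: real_cone_def algebra_simps)
qed

text \<open>The supremum in the dual norm is that of a nonempty bounded set.\<close>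

lemma (in quasi_normed_cone) dual_norm_bdd_above:
  assumes "f \<in> carrier (dual_cone X p)"
  shows "bdd_above ((\<lambda>x. pos_norm (f x)) ` {x \<in> carrier X. p x \<le> 1})"
proof -
  interpret R: quasi_normed_cone real_cone pos_norm by (rule quasi_normed_real_cone)
  have lin: "linear_map X real_cone f"
    and cont: "continuous_map (qtopology X p) (qtopology real_cone pos_norm) f"
    using assms by (auto simp: dual_cone_def)
  have f_scale: "f (r \<odot> x) = r * f x" if "x \<in> carrier X" "0 \<le> r" for x r
  proof -
    have "f (r \<odot> x \<otimes> 0 \<odot> x) = r * f x + 0 * f x"
      using lin that unfolding linear_map_def real_cone_def by fastforce
    then show ?thesis using that by simp
  qed
  have "f \<one> = 0" using f_scale[of \<one> 0] by simp
  define U where "U = qball real_cone pos_norm 0 1"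
  have U: "U = {..<1}"
    unfolding U_def by (subst R.qball_eq) (auto simp: real_cone_def pos_norm_def)
  have "openin (qtopology real_cone pos_norm) U"
    unfolding R.openin_qtopology_iff
    using R.qball_subset[of 0] by (auto simp: U_def qball_def) (simp_all add: real_cone_def)
  then have "openin (qtopology X p) {x \<in> carrier X. f x \<in> U}"
    using cont openin_continuous_map_preimage topspace_qtopology by metis
  moreover have "\<one> \<in> {x \<in> carrier X. f x \<in> U}" using \<open>f \<one> = 0\<close> U by simp
  ultimately obtain d where d: "d > 0" "qball X p \<one> d \<subseteq> {x \<in> carrier X. f x \<in> U}"
    unfolding openin_qtopology_iff by blast
  have "pos_norm (f x) \<le> 2 / d" if x: "x \<in> carrier X" "p x \<le> 1" for x
  proof -
    have "p ((d/2) \<odot> x) < d"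
      using x d mult_left_mono[of "p x" 1 "d/2"] by (simp add: p_scale)
    then have "(d/2) \<odot> x \<in> qball X p \<one> d"
      using x d by (subst qball_eq) (auto intro!: exI[of _ "(d/2) \<odot> x"])
    then have "f ((d/2) \<odot> x) < 1" using d U by auto
    then have "(d/2) * f x < 1" using f_scale x d by simp
    then show ?thesis using d by (simp add: pos_norm_def field_simps)
  qed
  then show ?thesis by (auto intro!: bdd_aboveI)
qed

end

theory Submission
  imports Defs
begin

text \<open>For a linear functional \<open>f\<close>, continuity means that \<open>f x \<le> C p(x)\<close> for some \<open>C \<ge> 0\<close>, and
  \<open>\<parallel>f\<parallel>\<close> is the least such \<open>C\<close>. A functional vanishing on \<open>G\<^sub>Y\<close> is constant on the
  classes \<open>[x]\<close>, so that \<open>f x \<le> C p(x + y)\<close> for all \<open>y \<in> G\<^sub>Y\<close> as soon as \<open>f\<close> is bounded by \<open>C\<close>;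
  hence \<open>f\<close> and the functional it induces on \<open>X/Y\<close> admit exactly the same constants \<open>C\<close>.\<close>

section \<open>Linear maps\<close>

text \<open>Coefficients 1 and 1 isolate additivity; a second coefficient 0 isolates homogeneity,
  because 0 times any element is the neutral element.\<close>

lemma linear_map_iff:
  assumes "rcone X" "rcone Z"
  shows "linear_map X Z f \<longleftrightarrow> f \<in> carrier X \<rightarrow> carrier Z \<and>
     (\<forall>x\<in>carrier X. \<forall>y\<in>carrier X. f (x \<otimes>\<^bsub>X\<^esub> y) = f x \<otimes>\<^bsub>Z\<^esub> f y) \<and>
     (\<forall>x\<in>carrier X. \<forall>r\<ge>0. f (r \<odot>\<^bsub>X\<^esub> x) = r \<odot>\<^bsub>Z\<^esub> f x)" (is "_ \<longleftrightarrow> ?R")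
proof -
  interpret X: rcone X by fact
  interpret Z: rcone Z by fact
  show ?thesis
  proof
    assume L: "linear_map X Z f"
    then have f: "f x \<in> carrier Z" if "x \<in> carrier X" for x
      using that by (auto simp: linear_map_def)
    have comb: "f (r \<odot>\<^bsub>X\<^esub> x \<otimes>\<^bsub>X\<^esub> s \<odot>\<^bsub>X\<^esub> y) = r \<odot>\<^bsub>Z\<^esub> f x \<otimes>\<^bsub>Z\<^esub> s \<odot>\<^bsub>Z\<^esub> f y"
      if "x \<in> carrier X" "y \<in> carrier X" "0 \<le> r" "0 \<le> s" for x y r s
      using L that by (auto simp: linear_map_def)
    have "f (x \<otimes>\<^bsub>X\<^esub> y) = f x \<otimes>\<^bsub>Z\<^esub> f y" if "x \<in> carrier X" "y \<in> carrier X" for x y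
      using comb[OF that, of 1 1] that f by simp
    moreover have "f (r \<odot>\<^bsub>X\<^esub> x) = r \<odot>\<^bsub>Z\<^esub> f x" if "x \<in> carrier X" "0 \<le> r" for x r
      using comb[OF that(1) that(1) that(2), of 0] that f by simp
    ultimately show ?R using f by blast
  next
    assume ?R
    then show "linear_map X Z f" by (auto simp: linear_map_def)
  qed
qed

lemma linear_map_real_iff:
  assumes "rcone X"
  shows "linear_map X real_cone f \<longleftrightarrow>
     (\<forall>x\<in>carrier X. \<forall>y\<in>carrier X. f (x \<otimes>\<^bsub>X\<^esub> y) = f x + f y) \<and>
     (\<forall>x\<in>carrier X. \<forall>r\<ge>0. f (r \<odot>\<^bsub>X\<^esub> x) = r * f x)"
  using linear_map_iff[OF assms, of real_cone f] quasi_normed_real_cone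
  by (auto simp: quasi_normed_cone_def real_cone_def)

text \<open>By \<open>qball_eq\<close>, a ball at \<open>x\<close> consists of the points x + a with
  \<open>p a\<close> small. Additivity turns the increment \<open>a\<close> into the increment
  \<open>f a\<close>, so the bound on \<open>f\<close> yields continuity at every point.\<close>

lemma linear_map_bounded_imp_continuous:
  assumes X: "quasi_normed_cone X p" and Z: "quasi_normed_cone Z q"
    and lin: "linear_map X Z f"
    and C: "0 \<le> C" and bd: "\<And>x. x \<in> carrier X \<Longrightarrow> q (f x) \<le> C * p x"
  shows "continuous_map (qtopology X p) (qtopology Z q) f"
proof -
  interpret X: quasi_normed_cone X p by fact
  interpret Z: quasi_normed_cone Z q by fact
  have f: "f x \<in> carrier Z" if "x \<in> carrier X" for x
    using lin that by (auto simp: linear_map_def)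
  have add: "f (x \<otimes>\<^bsub>X\<^esub> y) = f x \<otimes>\<^bsub>Z\<^esub> f y" if "x \<in> carrier X" "y \<in> carrier X" for x y
    using lin that linear_map_iff[OF X.rcone_axioms Z.rcone_axioms] by blast
  have "openin (qtopology X p) {x \<in> carrier X. f x \<in> U}" if U: "openin (qtopology Z q) U" for U
    unfolding X.openin_qtopology_iff
  proof (intro conjI ballI)
    fix x assume x: "x \<in> {x \<in> carrier X. f x \<in> U}"
    then obtain r where r: "r > 0" "qball Z q (f x) r \<subseteq> U"
      using U unfolding Z.openin_qtopology_iff by blast
    \<comment> \<open>The radius \<open>r / (C + 1)\<close> instead of \<open>r / C\<close> covers
      the case C = 0.\<close>
    have "f (x \<otimes>\<^bsub>X\<^esub> a) \<in> U" if a: "a \<in> carrier X" "p a < r / (C + 1)" for a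
    proof -
      have "q (f a) \<le> C * p a" using bd a by blast
      also have "\<dots> \<le> (C + 1) * p a" using X.p_nonneg a by (simp add: algebra_simps)
      also have "\<dots> < r" using a C by (simp add: field_simps)
      finally have "f x \<otimes>\<^bsub>Z\<^esub> f a \<in> qball Z q (f x) r"
        using x a f Z.qball_eq by auto
      then show ?thesis using r x a add by auto
    qed
    then have "qball X p x (r / (C + 1)) \<subseteq> {x \<in> carrier X. f x \<in> U}"
      using x X.qball_eq[of x] by auto
    then show "\<exists>s>0. qball X p x s \<subseteq> {x \<in> carrier X. f x \<in> U}"
      using r C by (intro exI[of _ "r / (C + 1)"]) auto
  qed auto
  then show ?thesis
    using f by (auto simp: continuous_map_def X.topspace_qtopology Z.topspace_qtopology)
qed

text \<open>Continuity comes for free: \<open>T\<close> and its inverse are linear and preserve the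
  quasi-norms, so both are bounded with constant 1. The explicit map \<open>S\<close> serves to
  establish bijectivity; the definition itself speaks of \<open>inv_into\<close>.\<close>

lemma isometrically_isomorphicI:
  assumes A: "quasi_normed_cone A a" and B: "quasi_normed_cone B b"
    and T: "linear_map A B T" and S: "S \<in> carrier B \<rightarrow> carrier A"
    and ST: "\<And>x. x \<in> carrier A \<Longrightarrow> S (T x) = x" and TS: "\<And>y. y \<in> carrier B \<Longrightarrow> T (S y) = y"
    and iso: "\<And>x. x \<in> carrier A \<Longrightarrow> b (T x) = a x"
  shows "isometrically_isomorphic A a B b"
proof -
  interpret A: quasi_normed_cone A a by fact
  interpret B: quasi_normed_cone B b by fact
  note lin = linear_map_iff[OF A.rcone_axioms B.rcone_axioms]
    linear_map_iff[OF B.rcone_axioms A.rcone_axioms]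
  let ?T' = "inv_into (carrier A) T"
  have Tc: "T \<in> carrier A \<rightarrow> carrier B" using T lin by blast
  have bij: "bij_betw T (carrier A) (carrier B)"
    using Tc S ST TS by (rule bij_betwI)
  have T'c: "?T' y \<in> carrier A" if "y \<in> carrier B" for y
    using bij that by (metis bij_betw_imp_surj_on inv_into_into)
  have TT': "T (?T' y) = y" if "y \<in> carrier B" for y
    using bij that by (rule bij_betw_inv_into_right)
  have T'T: "?T' (T x) = x" if "x \<in> carrier A" for x
    using bij that by (rule bij_betw_inv_into_left)
  \<comment> \<open>Linearity of the inverse is checked after applying \<open>T\<close>, which is
    injective on the carrier.\<close>
  have "?T' (y \<otimes>\<^bsub>B\<^esub> z) = ?T' y \<otimes>\<^bsub>A\<^esub> ?T' z" if "y \<in> carrier B" "z \<in> carrier B" for y z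
  proof -
    have "T (?T' y \<otimes>\<^bsub>A\<^esub> ?T' z) = y \<otimes>\<^bsub>B\<^esub> z" using T lin that T'c TT' by simp
    then show ?thesis using T'T[of "?T' y \<otimes>\<^bsub>A\<^esub> ?T' z"] that T'c by simp
  qed
  moreover have "?T' (r \<odot>\<^bsub>B\<^esub> y) = r \<odot>\<^bsub>A\<^esub> ?T' y" if "y \<in> carrier B" "0 \<le> r" for y r
  proof -
    have "T (r \<odot>\<^bsub>A\<^esub> ?T' y) = r \<odot>\<^bsub>B\<^esub> y" using T lin that T'c TT' by simp
    then show ?thesis using T'T[of "r \<odot>\<^bsub>A\<^esub> ?T' y"] that T'c by simp
  qed
  ultimately have T': "linear_map B A ?T'" using lin T'c by auto
  have "continuous_map (qtopology A a) (qtopology B b) T"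
    using A B T by (rule linear_map_bounded_imp_continuous[where C=1]) (auto simp: iso)
  moreover have "a (?T' y) = b y" if "y \<in> carrier B" for y
    using iso[OF T'c[OF that]] TT' that by simp
  then have "continuous_map (qtopology B b) (qtopology A a) ?T'"
    using B A T' by (intro linear_map_bounded_imp_continuous[where C=1]) auto
  ultimately show ?thesis
    unfolding isometrically_isomorphic_def using A B bij T iso by blast
qed


section \<open>Subcones\<close>

lemma subconeI:
  assumes "rcone X" "Y \<subseteq> carrier X" "\<one>\<^bsub>X\<^esub> \<in> Y"
    and "\<And>x y. x \<in> Y \<Longrightarrow> y \<in> Y \<Longrightarrow> x \<otimes>\<^bsub>X\<^esub> y \<in> Y"
    and "\<And>r x. 0 \<le> r \<Longrightarrow> x \<in> Y \<Longrightarrow> r \<odot>\<^bsub>X\<^esub> x \<in> Y"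
  shows "subcone Y X"
proof -
  interpret rcone X by fact
  have "rcone (X\<lparr>carrier := Y\<rparr>)"
    using assms by unfold_locales
      (auto simp: subset_iff m_ac scale_scale scale_add add_scale)
  then show ?thesis using assms by (simp add: subcone_def)
qed

text \<open>The delicate axiom is (i), since \<open>Units\<close> and \<open>inv\<close> depend on
  the carrier. An element invertible in \<open>Y\<close> is invertible in \<open>X\<close> with the
  same inverse, so axiom (i) of \<open>X\<close> applies to it.\<close>

lemma quasi_normed_subcone:
  assumes "quasi_normed_cone X p" and sub: "subcone Y X"
  shows "quasi_normed_cone (X\<lparr>carrier := Y\<rparr>) p"
proof -
  interpret X: quasi_normed_cone X p by fact
  let ?Y = "X\<lparr>carrier := Y\<rparr>"
  interpret Y: rcone ?Y using sub by (simp add: subcone_def)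
  have YX: "x \<in> carrier X" if "x \<in> Y" for x using sub that by (auto simp: subcone_def)
  have "x \<in> Units X \<and> inv\<^bsub>?Y\<^esub> x = inv\<^bsub>X\<^esub> x" if x: "x \<in> Units ?Y" for x
  proof -
    have "x \<in> Y" "inv\<^bsub>?Y\<^esub> x \<in> Y" "x \<otimes>\<^bsub>X\<^esub> inv\<^bsub>?Y\<^esub> x = \<one>\<^bsub>X\<^esub>" "inv\<^bsub>?Y\<^esub> x \<otimes>\<^bsub>X\<^esub> x = \<one>\<^bsub>X\<^esub>"
      using x Y.Units_closed[of x] Y.Units_inv_closed[of x] Y.Units_r_inv[of x] Y.Units_l_inv[of x]
      by simp_all
    then show ?thesis
      using YX X.inv_unique'[of x "inv\<^bsub>?Y\<^esub> x"] by (auto simp: Units_def)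
  qed
  moreover have "\<one>\<^bsub>X\<^esub> \<in> Units ?Y" using Y.Units_one_closed by simp
  moreover have "x = \<one>\<^bsub>X\<^esub> \<longleftrightarrow> x \<in> Units X \<and> p x = 0 \<and> p (inv\<^bsub>X\<^esub> x) = 0" if "x \<in> Y" for x
    using X.quasi_norm YX[OF that] unfolding quasi_norm_def by blast
  ultimately have "x = \<one>\<^bsub>X\<^esub> \<longleftrightarrow> x \<in> Units ?Y \<and> p x = 0 \<and> p (inv\<^bsub>?Y\<^esub> x) = 0" if "x \<in> Y" for x
    using that by metis
  then have "quasi_norm ?Y p"
    using YX by (auto simp: quasi_norm_def X.p_nonneg X.p_scale X.p_add)
  then show ?thesis
    by unfold_locales (auto dest: YX X.cancel)
qed


section \<open>The dual cone\<close>

context quasi_normed_cone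
begin

section \<open>The dual norm as the least bounding constant\<close>

lemma dual_norm_upper:
  assumes "f \<in> carrier (dual_cone X p)" "x \<in> carrier X" "p x \<le> 1"
  shows "f x \<le> dual_norm X p f"
proof -
  have "pos_norm (f x) \<le> dual_norm X p f"
    unfolding dual_norm_def using assms by (intro cSUP_upper dual_norm_bdd_above) auto
  then show ?thesis by (simp add: pos_norm_def)
qed

lemma dual_norm_nonneg:
  assumes "f \<in> carrier (dual_cone X p)"
  shows "0 \<le> dual_norm X p f"
proof -
  have "pos_norm (f \<one>) \<le> dual_norm X p f"
    unfolding dual_norm_def using assms by (intro cSUP_upper dual_norm_bdd_above) (auto simp: p_zero)
  then show ?thesis by (simp add: pos_norm_def)
qed

text \<open>If p(x) > 0, rescale \<open>x\<close> to p-value 1. If p(x) = 0, every nonnegative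
  multiple of \<open>x\<close> lies in the unit ball, so f(x) > 0 would make \<open>f\<close>
  unbounded there.\<close>

lemma le_dual_norm_mult:
  assumes f: "f \<in> carrier (dual_cone X p)" and x: "x \<in> carrier X"
  shows "f x \<le> dual_norm X p f * p x"
proof -
  let ?N = "dual_norm X p f"
  have sc: "f (r \<odot> x) = r * f x" if "0 \<le> r" for r
    using f x that by (simp add: dual_cone_def linear_map_real_iff[OF rcone_axioms])
  have step: "r * f x \<le> ?N" if "0 \<le> r" "r * p x \<le> 1" for r
    using dual_norm_upper[OF f, of "r \<odot> x"] that x by (simp add: sc p_scale)
  show ?thesis
  proof (cases "p x = 0")
    case True
    have "f x \<le> 0"
    proof (rule ccontr)
      assume "\<not> f x \<le> 0"
      then show False
        \<comment> \<open>With this factor the multiple of \<open>x\<close> has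
          \<open>f\<close>-value \<open>?N + 1\<close>, exceeding the supremum
          \<open>?N\<close>.\<close>
        using step[of "(?N + 1) / f x"] dual_norm_nonneg[OF f] True by simp
    qed
    then show ?thesis using True by simp
  next
    case False
    then have "p x > 0" using p_nonneg[OF x] by simp
    then show ?thesis using step[of "1 / p x"] by (simp add: field_simps)
  qed
qed

text \<open>This characterizes the norm by its upper bounds, so that later norm estimates reduce to
  pointwise inequalities without touching the supremum.\<close>

lemma dual_norm_le_iff:
  assumes f: "f \<in> carrier (dual_cone X p)" and C: "0 \<le> C"
  shows "dual_norm X p f \<le> C \<longleftrightarrow> (\<forall>x\<in>carrier X. f x \<le> C * p x)"
proof
  assume "dual_norm X p f \<le> C"
  then show "\<forall>x\<in>carrier X. f x \<le> C * p x"
    using le_dual_norm_mult[OF f] p_nonneg by (meson mult_right_mono order_trans)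
next
  assume R: "\<forall>x\<in>carrier X. f x \<le> C * p x"
  have "pos_norm (f x) \<le> C" if x: "x \<in> carrier X" "p x \<le> 1" for x
    using R x C mult_left_mono[of "p x" 1 C] by (force simp: pos_norm_def)
  moreover have "\<one> \<in> {x \<in> carrier X. p x \<le> 1}" by (simp add: p_zero)
  ultimately show "dual_norm X p f \<le> C"
    unfolding dual_norm_def by (intro cSUP_least) auto
qed

text \<open>Continuity is traded for a one-sided bound: the dual norm supplies \<open>C\<close>, and
  conversely f(x) \<le> C p(x) bounds \<open>pos_norm (f x)\<close> too, because the right-hand side
  is nonnegative.\<close>

lemma dual_cone_carrier_iff:
  "f \<in> carrier (dual_cone X p) \<longleftrightarrow> f \<in> extensional (carrier X) \<and>
     (\<forall>x\<in>carrier X. \<forall>y\<in>carrier X. f (x \<otimes> y) = f x + f y) \<and>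
     (\<forall>x\<in>carrier X. \<forall>r\<ge>0. f (r \<odot> x) = r * f x) \<and>
     (\<exists>C\<ge>0. \<forall>x\<in>carrier X. f x \<le> C * p x)" (is "_ \<longleftrightarrow> ?R")
proof
  assume f: "f \<in> carrier (dual_cone X p)"
  moreover have "\<exists>C\<ge>0. \<forall>x\<in>carrier X. f x \<le> C * p x"
    using dual_norm_nonneg[OF f] le_dual_norm_mult[OF f] by blast
  ultimately show ?R
    unfolding dual_cone_def linear_map_real_iff[OF rcone_axioms] by simp
next
  assume R: ?R
  then have lin: "linear_map X real_cone f"
    by (simp add: linear_map_real_iff[OF rcone_axioms])
  obtain C where C: "C \<ge> 0" "\<forall>x\<in>carrier X. f x \<le> C * p x" using R by blast
  have "continuous_map (qtopology X p) (qtopology real_cone pos_norm) f"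
    using C by (intro linear_map_bounded_imp_continuous[OF quasi_normed_cone_axioms
          quasi_normed_real_cone lin, of C]) (auto simp: pos_norm_def p_nonneg)
  then show "f \<in> carrier (dual_cone X p)" using R lin by (simp add: dual_cone_def)
qed

section \<open>Cone and quasi-norm structure of the dual\<close>

lemma dual_carrier_zero: "(\<lambda>x\<in>carrier X. 0) \<in> carrier (dual_cone X p)"
  unfolding dual_cone_carrier_iff by (auto intro: exI[of _ 0])

lemma dual_carrier_add:
  assumes f: "f \<in> carrier (dual_cone X p)" and g: "g \<in> carrier (dual_cone X p)"
  shows "(\<lambda>x\<in>carrier X. f x + g x) \<in> carrier (dual_cone X p)"
proof -
  have "f x + g x \<le> (dual_norm X p f + dual_norm X p g) * p x" if "x \<in> carrier X" for x
    using le_dual_norm_mult[OF f that] le_dual_norm_mult[OF g that] by (simp add: algebra_simps)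
  then have "\<exists>C\<ge>0. \<forall>x\<in>carrier X. f x + g x \<le> C * p x"
    using dual_norm_nonneg[OF f] dual_norm_nonneg[OF g] by (meson add_nonneg_nonneg)
  then show ?thesis
    using f g unfolding dual_cone_carrier_iff by (auto simp: algebra_simps)
qed

lemma dual_carrier_scale:
  assumes f: "f \<in> carrier (dual_cone X p)" and r: "0 \<le> r"
  shows "(\<lambda>x\<in>carrier X. r * f x) \<in> carrier (dual_cone X p)"
proof -
  have "r * f x \<le> (r * dual_norm X p f) * p x" if "x \<in> carrier X" for x
    using mult_left_mono[OF le_dual_norm_mult[OF f that] r] by (simp add: algebra_simps)
  then have "\<exists>C\<ge>0. \<forall>x\<in>carrier X. r * f x \<le> C * p x"
    using dual_norm_nonneg[OF f] r by (meson mult_nonneg_nonneg)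
  then show ?thesis
    using f r unfolding dual_cone_carrier_iff by (auto simp: algebra_simps)
qed

lemma dual_cone_simps:
  "\<one>\<^bsub>dual_cone X p\<^esub> = (\<lambda>x\<in>carrier X. 0)"
  "f \<otimes>\<^bsub>dual_cone X p\<^esub> g = (\<lambda>x\<in>carrier X. f x + g x)"
  "r \<odot>\<^bsub>dual_cone X p\<^esub> f = (\<lambda>x\<in>carrier X. r * f x)"
  by (simp_all add: dual_cone_def)

lemma dual_extensional: "f \<in> carrier (dual_cone X p) \<Longrightarrow> f \<in> extensional (carrier X)"
  by (simp add: dual_cone_def)

lemma rcone_dual: "rcone (dual_cone X p)"
  by unfold_locales
    (auto simp: dual_cone_simps dual_carrier_zero dual_carrier_add dual_carrier_scale algebra_simps
      extensional_restrict cong: restrict_cong dest!: dual_extensional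
      intro!: restrict_ext extensionalityI[of _ "carrier X"])

lemma dual_norm_zero: "dual_norm X p (\<lambda>x\<in>carrier X. 0) = 0"
  using dual_norm_le_iff[OF dual_carrier_zero, of 0] dual_norm_nonneg[OF dual_carrier_zero]
  by auto

lemma dual_norm_add:
  assumes f: "f \<in> carrier (dual_cone X p)" and g: "g \<in> carrier (dual_cone X p)"
  shows "dual_norm X p (\<lambda>x\<in>carrier X. f x + g x) \<le> dual_norm X p f + dual_norm X p g"
proof -
  have "f x + g x \<le> (dual_norm X p f + dual_norm X p g) * p x" if "x \<in> carrier X" for x
    using le_dual_norm_mult[OF f that] le_dual_norm_mult[OF g that] by (simp add: algebra_simps)
  then show ?thesis
    using dual_norm_nonneg[OF f] dual_norm_nonneg[OF g]
    by (subst dual_norm_le_iff[OF dual_carrier_add[OF f g]]) auto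
qed

text \<open>For r > 0 the functionals \<open>f\<close> and r f determine each other, so each norm
  gives a bounding constant for the other functional. The case r = 0 is separate because of the
  division by \<open>r\<close>.\<close>

lemma dual_norm_scale:
  assumes f: "f \<in> carrier (dual_cone X p)" and r: "0 \<le> r"
  shows "dual_norm X p (\<lambda>x\<in>carrier X. r * f x) = r * dual_norm X p f"
proof (cases "r = 0")
  case True
  then show ?thesis using dual_norm_zero by (simp cong: restrict_cong)
next
  case False
  then have r: "r > 0" using r by simp
  let ?g = "\<lambda>x\<in>carrier X. r * f x"
  have g: "?g \<in> carrier (dual_cone X p)" using dual_carrier_scale f r by simp
  have "dual_norm X p ?g \<le> r * dual_norm X p f"
    using le_dual_norm_mult[OF f] dual_norm_nonneg[OF f] r
    by (subst dual_norm_le_iff[OF g]) auto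
  moreover have "dual_norm X p f \<le> dual_norm X p ?g / r"
    using le_dual_norm_mult[OF g] dual_norm_nonneg[OF g] r
    by (subst dual_norm_le_iff[OF f]) (auto simp: field_simps)
  ultimately show ?thesis using r by (simp add: field_simps)
qed

text \<open>For axiom (i): if a functional and its inverse both have norm 0, both are nonpositive on
  the cone; as they add up to 0, both vanish there. Cancellation holds pointwise in the
  reals.\<close>

lemma quasi_normed_dual: "quasi_normed_cone (dual_cone X p) (dual_norm X p)"
proof -
  interpret D: rcone "dual_cone X p" by (rule rcone_dual)
  let ?D = "dual_cone X p"
  have "f = \<one>\<^bsub>?D\<^esub>"
    if U: "f \<in> Units ?D" and 0: "dual_norm X p f = 0" "dual_norm X p (inv\<^bsub>?D\<^esub> f) = 0" for f
  proof
    fix x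
    have f: "f \<in> carrier ?D" and f': "inv\<^bsub>?D\<^esub> f \<in> carrier ?D" using U by auto
    show "f x = \<one>\<^bsub>?D\<^esub> x"
    proof (cases "x \<in> carrier X")
      case True
      have "f x + (inv\<^bsub>?D\<^esub> f) x = 0"
        using fun_cong[OF D.Units_r_inv[OF U], of x] True by (simp add: dual_cone_simps)
      then show ?thesis
        using le_dual_norm_mult[OF f True] le_dual_norm_mult[OF f' True] 0 True
        by (simp add: dual_cone_simps)
    next
      case False
      \<comment> \<open>Outside the carrier both sides are the default value
        \<open>undefined\<close>.\<close>
      then show ?thesis using dual_extensional[OF f] by (simp add: dual_cone_simps extensional_def)
    qed
  qed
  moreover have "inv\<^bsub>?D\<^esub> \<one>\<^bsub>?D\<^esub> = \<one>\<^bsub>?D\<^esub>" by (rule D.inv_one)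
  moreover have "\<one>\<^bsub>?D\<^esub> \<in> Units ?D" by (rule D.Units_one_closed)
  moreover have "dual_norm X p \<one>\<^bsub>?D\<^esub> = 0" by (simp add: dual_cone_simps dual_norm_zero)
  ultimately have "f = \<one>\<^bsub>?D\<^esub> \<longleftrightarrow>
      f \<in> Units ?D \<and> dual_norm X p f = 0 \<and> dual_norm X p (inv\<^bsub>?D\<^esub> f) = 0" for f
    by metis
  then have "quasi_norm ?D (dual_norm X p)"
    unfolding quasi_norm_def
    by (auto simp: dual_norm_nonneg dual_norm_add dual_norm_scale dual_cone_simps(2,3))
  moreover have "f = g"
    if "f \<in> carrier ?D" "g \<in> carrier ?D" "h \<otimes>\<^bsub>?D\<^esub> f = h \<otimes>\<^bsub>?D\<^esub> g" for f g h
  proof (rule extensionalityI)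
    show "f \<in> extensional (carrier X)" "g \<in> extensional (carrier X)"
      using that dual_extensional by auto
    show "f x = g x" if "x \<in> carrier X" for x
      using fun_cong[OF \<open>h \<otimes>\<^bsub>?D\<^esub> f = h \<otimes>\<^bsub>?D\<^esub> g\<close>, of x] that by (simp add: dual_cone_simps)
  qed
  ultimately show ?thesis by unfold_locales
qed

lemma subcone_polar: "subcone (polar X p Y) (dual_cone X p)"
proof (rule subconeI)
  show "rcone (dual_cone X p)" by (rule rcone_dual)
qed (auto simp: polar_def dual_cone_simps dual_carrier_zero dual_carrier_add dual_carrier_scale
    invertibles_def)

end


section \<open>The quotient cone\<close>

context
  fixes X :: "'a rcone" (structure) and p :: "'a \<Rightarrow> real" and Y :: "'a set"
  assumes X: "quasi_normed_cone X p" and sub: "subcone Y X"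
begin

interpretation quasi_normed_cone X p by (fact X)

private abbreviation (input) "Q \<equiv> quotient_cone X Y"

lemma quotient_carrier: "carrier Q = coset X Y ` carrier X"
  and quotient_one: "\<one>\<^bsub>Q\<^esub> = coset X Y \<one>"
  by (simp_all add: quotient_cone_def)

lemma coset_eq_iff:
  assumes "x \<in> carrier X" "z \<in> carrier X"
  shows "coset X Y x = coset X Y z \<longleftrightarrow> (\<exists>g\<in>invertibles X Y. x = z \<otimes> g)"
  using coset_self[OF sub assms(1)] coset_shift[OF sub assms(2)] in_cosetE[OF sub] by metis

lemma rcone_quotient: "rcone Q"
  by unfold_locales
    (auto simp: quotient_carrier quotient_one quotient_add[OF sub] quotient_scale[OF sub]
      m_ac scale_scale scale_add add_scale)

section \<open>The infimum quasi-norm on the quotient\<close>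

lemma quotient_norm_le:
  assumes "x \<in> carrier X" "g \<in> invertibles X Y"
  shows "quotient_norm p (coset X Y x) \<le> p (x \<otimes> g)"
  unfolding quotient_norm_coset using assms invertibles_carrier[OF sub]
  by (intro cINF_lower) (auto simp: p_nonneg intro!: bdd_belowI[of _ 0])

lemma le_quotient_norm:
  assumes "x \<in> carrier X" "\<And>g. g \<in> invertibles X Y \<Longrightarrow> c \<le> p (x \<otimes> g)"
  shows "c \<le> quotient_norm p (coset X Y x)"
  unfolding quotient_norm_coset using assms invertibles_one[OF sub] by (intro cINF_greatest) auto

lemma quotient_norm_le_self:
  "x \<in> carrier X \<Longrightarrow> quotient_norm p (coset X Y x) \<le> p x"
  using quotient_norm_le[of x \<one>] invertibles_one[OF sub] by simp

lemma quotient_norm_nonneg: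
  "x \<in> carrier X \<Longrightarrow> 0 \<le> quotient_norm p (coset X Y x)"
  using invertibles_carrier[OF sub] by (intro le_quotient_norm) (auto simp: p_nonneg)

text \<open>A near-optimal representative stands in for a minimizer of the infimum.\<close>

lemma quotient_norm_approx:
  assumes "x \<in> carrier X" "0 < e"
  obtains g where "g \<in> invertibles X Y" "p (x \<otimes> g) < quotient_norm p (coset X Y x) + e"
  using le_quotient_norm[OF assms(1), of "quotient_norm p (coset X Y x) + e"] assms(2)
  by (meson less_add_same_cancel1 not_le)

text \<open>Take \<open>g\<close> and \<open>h\<close> optimal up to e/2 for the two classes; their
  sum is again in \<open>G\<^sub>Y\<close> and competes in the infimum for the class of x +
  z.\<close>

lemma quotient_norm_add:
  assumes x: "x \<in> carrier X" and z: "z \<in> carrier X"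
  shows "quotient_norm p (coset X Y (x \<otimes> z)) \<le>
    quotient_norm p (coset X Y x) + quotient_norm p (coset X Y z)"
proof (rule field_le_epsilon)
  fix e :: real assume "0 < e"
  then have e: "0 < e / 2" by simp
  obtain g where g: "g \<in> invertibles X Y" "p (x \<otimes> g) < quotient_norm p (coset X Y x) + e / 2"
    using quotient_norm_approx[OF x e] .
  obtain h where h: "h \<in> invertibles X Y" "p (z \<otimes> h) < quotient_norm p (coset X Y z) + e / 2"
    using quotient_norm_approx[OF z e] .
  note gh = g(1)[THEN invertibles_carrier[OF sub]] h(1)[THEN invertibles_carrier[OF sub]]
  have "quotient_norm p (coset X Y (x \<otimes> z)) \<le> p (x \<otimes> z \<otimes> (g \<otimes> h))"
    using x z g h by (intro quotient_norm_le invertibles_add[OF sub]) auto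
  also have "x \<otimes> z \<otimes> (g \<otimes> h) = (x \<otimes> g) \<otimes> (z \<otimes> h)"
    using x z gh by (simp add: m_ac)
  also have "p \<dots> \<le> p (x \<otimes> g) + p (z \<otimes> h)" using x z gh by (intro p_add) auto
  finally show "quotient_norm p (coset X Y (x \<otimes> z)) \<le>
      quotient_norm p (coset X Y x) + quotient_norm p (coset X Y z) + e"
    using g(2) h(2) by simp
qed

lemma quotient_norm_one: "quotient_norm p (coset X Y \<one>) = 0"
  using quotient_norm_le_self[of \<one>] quotient_norm_nonneg[of \<one>] p_zero by simp

text \<open>For a positive factor \<open>s\<close>, multiplication by \<open>s\<close> keeps
  \<open>G\<^sub>Y\<close> inside itself, which gives \<le>. The reverse inequality is the same
  estimate for the factor 1/r at the point r x.\<close>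

lemma quotient_norm_scale:
  assumes x: "x \<in> carrier X" and r: "0 \<le> r"
  shows "quotient_norm p (coset X Y (r \<odot> x)) = r * quotient_norm p (coset X Y x)"
proof (cases "r = 0")
  case True
  then show ?thesis using x by (simp add: quotient_norm_one)
next
  case False
  have le: "quotient_norm p (coset X Y (s \<odot> z)) \<le> s * quotient_norm p (coset X Y z)"
    if z: "z \<in> carrier X" and s: "0 < s" for z s
  proof -
    have "quotient_norm p (coset X Y (s \<odot> z)) / s \<le> quotient_norm p (coset X Y z)"
    proof (rule le_quotient_norm[OF z])
      fix g assume g: "g \<in> invertibles X Y"
      note gc = invertibles_carrier[OF sub g]
      have "quotient_norm p (coset X Y (s \<odot> z)) \<le> p (s \<odot> z \<otimes> s \<odot> g)"
        using z s g by (intro quotient_norm_le invertibles_scale[OF sub]) auto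
      also have "\<dots> = s * p (z \<otimes> g)"
        using z s gc by (simp add: scale_add[symmetric] p_scale)
      finally show "quotient_norm p (coset X Y (s \<odot> z)) / s \<le> p (z \<otimes> g)"
        using s by (simp add: field_simps)
    qed
    then show ?thesis using s by (simp add: field_simps)
  qed
  have r: "0 < r" using r False by simp
  have "quotient_norm p (coset X Y ((1 / r) \<odot> (r \<odot> x))) \<le>
      (1 / r) * quotient_norm p (coset X Y (r \<odot> x))"
    using x r by (intro le) auto
  then have "r * quotient_norm p (coset X Y x) \<le> quotient_norm p (coset X Y (r \<odot> x))"
    using x r by (simp add: scale_scale field_simps)
  with le[OF x r] show ?thesis by simp
qed

text \<open>If \<open>x\<close> is invertible and \<open>p (x + y)\<close> is small for some \<open>y \<in> G\<^sub>Y\<close>, then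
  \<open>y = - x + (x + y)\<close> is close to \<open>- x\<close>; so a vanishing quotient norm puts \<open>- x\<close> in the closure of \<open>G\<^sub>Y\<close>.\<close>

lemma quotient_norm_eq_zero:
  assumes closed: "qtopology X p closure_of invertibles X Y = invertibles X Y"
    and x: "x \<in> Units X" and 0: "quotient_norm p (coset X Y x) = 0"
  shows "coset X Y x = coset X Y \<one>"
proof -
  have xc: "x \<in> carrier X" and x'c: "inv x \<in> carrier X" using x by auto
  have "inv x \<in> qtopology X p closure_of invertibles X Y"
    unfolding in_closure_of topspace_qtopology
  proof (intro conjI allI impI)
    fix U assume "inv x \<in> U \<and> openin (qtopology X p) U"
    then obtain r where r: "r > 0" "qball X p (inv x) r \<subseteq> U"
      unfolding openin_qtopology_iff by blast
    obtain g where g: "g \<in> invertibles X Y" "p (x \<otimes> g) < r"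
      using quotient_norm_approx[OF xc r(1)] 0 by auto
    have gc: "g \<in> carrier X" using invertibles_carrier[OF sub g(1)] .
    have "inv x \<otimes> (x \<otimes> g) = g"
      using xc x'c gc x by (simp add: m_assoc[symmetric])
    then have "g \<in> qball X p (inv x) r"
      unfolding qball_eq[OF x'c] using g gc xc by (auto intro!: exI[of _ "x \<otimes> g"])
    then show "\<exists>y. y \<in> invertibles X Y \<and> y \<in> U" using g r by blast
  qed (rule x'c)
  then have "inv x \<in> invertibles X Y" using closed by simp
  from invertibles_uminus[OF sub this] have "x \<in> invertibles X Y" using x by simp
  then show ?thesis using coset_shift[OF sub one_closed, of x] xc by simp
qed

text \<open>For axiom (i), a unit of the quotient is lifted to a unit of \<open>X\<close>: if [x] +
  [z] = [0], then x + z = g with g in \<open>G\<^sub>Y\<close>, so z - g is the inverse of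
  \<open>x\<close>. Then \<open>quotient_norm_eq_zero\<close> applies.\<close>

lemma quasi_normed_quotient:
  assumes closed: "qtopology X p closure_of invertibles X Y = invertibles X Y"
  shows "quasi_normed_cone Q (quotient_norm p)"
proof -
  interpret Q: rcone Q by (rule rcone_quotient)
  have "A = \<one>\<^bsub>Q\<^esub>" if U: "A \<in> Units Q" and 0: "quotient_norm p A = 0" for A
  proof -
    obtain x where x: "x \<in> carrier X" "A = coset X Y x"
      using U Q.Units_closed[of A] by (auto simp: quotient_carrier)
    obtain z where z: "z \<in> carrier X" "inv\<^bsub>Q\<^esub> A = coset X Y z"
      using U Q.Units_inv_closed[of A] by (auto simp: quotient_carrier)
    have "coset X Y (x \<otimes> z) = coset X Y \<one>"
      using Q.Units_r_inv[OF U] x z by (simp add: quotient_add[OF sub] quotient_one)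
    then obtain g where g: "g \<in> invertibles X Y" "x \<otimes> z = \<one> \<otimes> g"
      using x z by (auto simp: coset_eq_iff)
    have g': "inv g \<in> carrier X" "g \<otimes> inv g = \<one>" "g \<in> carrier X"
      using invertibles_inv[OF sub g(1)] invertibles_carrier[OF sub g(1)] by auto
    have "x \<otimes> (z \<otimes> inv g) = \<one>"
      using g g' x z by (simp add: m_assoc[symmetric])
    then have "x \<in> Units X"
      using x z g' by (auto simp: Units_def m_comm intro!: bexI[of _ "z \<otimes> inv g"])
    then show ?thesis using quotient_norm_eq_zero[OF closed] x 0 by (simp add: quotient_one)
  qed
  moreover have "inv\<^bsub>Q\<^esub> \<one>\<^bsub>Q\<^esub> = \<one>\<^bsub>Q\<^esub>" by (rule Q.inv_one)
  moreover have "\<one>\<^bsub>Q\<^esub> \<in> Units Q" by (rule Q.Units_one_closed)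
  moreover have "quotient_norm p \<one>\<^bsub>Q\<^esub> = 0" by (simp add: quotient_one quotient_norm_one)
  ultimately have "A = \<one>\<^bsub>Q\<^esub> \<longleftrightarrow>
      A \<in> Units Q \<and> quotient_norm p A = 0 \<and> quotient_norm p (inv\<^bsub>Q\<^esub> A) = 0" for A
    by metis
  then have "quasi_norm Q (quotient_norm p)"
    unfolding quasi_norm_def
    by (auto simp: quotient_carrier quotient_norm_nonneg quotient_add[OF sub] quotient_scale[OF sub]
        quotient_norm_add quotient_norm_scale)
  moreover have "coset X Y x = coset X Y y"
    if c: "x \<in> carrier X" "y \<in> carrier X" "z \<in> carrier X"
      and eq: "coset X Y z \<otimes>\<^bsub>Q\<^esub> coset X Y x = coset X Y z \<otimes>\<^bsub>Q\<^esub> coset X Y y" for x y z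
  proof -
    \<comment> \<open>Equality of classes becomes an equation in \<open>X\<close> with a correction
      \<open>g\<close>; cancelling \<open>z\<close> there leaves x = y + g.\<close>
    obtain g where g: "g \<in> invertibles X Y" "z \<otimes> x = z \<otimes> y \<otimes> g"
      using eq c by (auto simp: quotient_add[OF sub] coset_eq_iff)
    have gc: "g \<in> carrier X" using invertibles_carrier[OF sub g(1)] .
    have "x = y \<otimes> g" using g c gc by (intro cancel[of x "y \<otimes> g" z]) (auto simp: m_assoc)
    then show ?thesis using coset_shift[OF sub c(2) g(1)] by simp
  qed
  ultimately show ?thesis
    by unfold_locales (auto simp: quotient_carrier)
qed


section \<open>Functionals on the quotient\<close>

text \<open>The value is read at an arbitrarily chosen representative; for \<open>f\<close> in the
  polar the choice is immaterial by \<open>descend_coset\<close>. The restriction matches the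
  normalization in \<open>dual_cone\<close>.\<close>

definition descend :: "('a \<Rightarrow> real) \<Rightarrow> 'a set \<Rightarrow> real" where
  "descend f = (\<lambda>A\<in>carrier Q. f (SOME x. x \<in> A))"

text \<open>Composition with the projection onto the quotient; it will be the inverse of
  \<open>descend\<close> on the polar.\<close>

definition pull_back :: "('a set \<Rightarrow> real) \<Rightarrow> 'a \<Rightarrow> real" where
  "pull_back h = (\<lambda>x\<in>carrier X. h (coset X Y x))"

lemma descend_extensional: "descend f \<in> extensional (carrier Q)"
  by (simp add: descend_def)

lemma polar_add_invertible:
  assumes "f \<in> polar X p Y" "x \<in> carrier X" "g \<in> invertibles X Y"
  shows "f (x \<otimes> g) = f x"
  using assms invertibles_carrier[OF sub] by (auto simp: polar_def dual_cone_carrier_iff)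

lemma descend_coset:
  assumes f: "f \<in> polar X p Y" and x: "x \<in> carrier X"
  shows "descend f (coset X Y x) = f x"
proof -
  have "(SOME z. z \<in> coset X Y x) \<in> coset X Y x"
    using coset_self[OF sub x] by (rule someI)
  then obtain g where "g \<in> invertibles X Y" "(SOME z. z \<in> coset X Y x) = x \<otimes> g"
    by (rule in_cosetE[OF sub])
  then show ?thesis
    using polar_add_invertible[OF f x] x by (simp add: descend_def quotient_carrier)
qed

lemma polar_bound_iff:
  assumes f: "f \<in> polar X p Y" and C: "0 \<le> C"
  shows "(\<forall>A\<in>carrier Q. descend f A \<le> C * quotient_norm p A) \<longleftrightarrow> (\<forall>x\<in>carrier X. f x \<le> C * p x)"
proof
  assume L: "\<forall>A\<in>carrier Q. descend f A \<le> C * quotient_norm p A"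
  show "\<forall>x\<in>carrier X. f x \<le> C * p x"
  proof
    fix x assume x: "x \<in> carrier X"
    have "f x \<le> C * quotient_norm p (coset X Y x)"
      using L x f by (auto simp: quotient_carrier descend_coset)
    also have "\<dots> \<le> C * p x" using C quotient_norm_le_self[OF x] by (intro mult_left_mono)
    finally show "f x \<le> C * p x" .
  qed
next
  assume R: "\<forall>x\<in>carrier X. f x \<le> C * p x"
  have "f x \<le> C * quotient_norm p (coset X Y x)" if x: "x \<in> carrier X" for x
  proof -
    have bd: "f x \<le> C * p (x \<otimes> g)" if "g \<in> invertibles X Y" for g
      using R x that invertibles_carrier[OF sub that] polar_add_invertible[OF f x that]
      by (metis m_closed)
    show ?thesis
    \<comment> \<open>The bound passes to the infimum after division by \<open>C\<close>, hence the
      case split.\<close>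
    proof (cases "C = 0")
      case True
      then show ?thesis using bd[OF invertibles_one[OF sub]] by simp
    next
      case False
      then have "f x / C \<le> quotient_norm p (coset X Y x)"
        using C bd by (intro le_quotient_norm[OF x]) (auto simp: field_simps)
      then show ?thesis using C False by (simp add: field_simps)
    qed
  qed
  then show "\<forall>A\<in>carrier Q. descend f A \<le> C * quotient_norm p A"
    using f by (auto simp: quotient_carrier descend_coset)
qed

section \<open>The isometry for closed \<open>G\<^sub>Y\<close>\<close>

context
  assumes closed: "qtopology X p closure_of invertibles X Y = invertibles X Y"
begin

text \<open>Closedness enters here: it makes the quotient a quasi-normed cone, so all results on
  duals are available for it as well.\<close>

interpretation Q: quasi_normed_cone Q "quotient_norm p"
  by (rule quasi_normed_quotient[OF closed])

lemma descend_in_dual: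
  assumes f: "f \<in> polar X p Y"
  shows "descend f \<in> carrier (dual_cone Q (quotient_norm p))"
proof -
  have fD: "f \<in> carrier (dual_cone X p)" using f by (simp add: polar_def)
  then obtain C where "0 \<le> C" "\<forall>x\<in>carrier X. f x \<le> C * p x"
    by (auto simp: dual_cone_carrier_iff)
  then have "\<exists>C\<ge>0. \<forall>A\<in>carrier Q. descend f A \<le> C * quotient_norm p A"
    using polar_bound_iff[OF f] by blast
  then show ?thesis
    using fD unfolding Q.dual_cone_carrier_iff
    by (auto simp: quotient_carrier quotient_add[OF sub] quotient_scale[OF sub]
        descend_coset[OF f] descend_extensional[unfolded quotient_carrier] dual_cone_carrier_iff)
qed

text \<open>Both norms are nonnegative and, by \<open>polar_bound_iff\<close>, have the same
  nonnegative upper bounds; using each as a bound for the other gives equality.\<close>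

lemma dual_norm_descend:
  assumes f: "f \<in> polar X p Y"
  shows "dual_norm Q (quotient_norm p) (descend f) = dual_norm X p f"
proof -
  have fD: "f \<in> carrier (dual_cone X p)" using f by (simp add: polar_def)
  have "dual_norm Q (quotient_norm p) (descend f) \<le> C \<longleftrightarrow> dual_norm X p f \<le> C" if "0 \<le> C" for C
    using that f
    by (simp add: dual_norm_le_iff[OF fD] Q.dual_norm_le_iff[OF descend_in_dual] polar_bound_iff)
  then show ?thesis
    using dual_norm_nonneg[OF fD] Q.dual_norm_nonneg[OF descend_in_dual[OF f]]
    by (metis order_antisym order_refl)
qed

text \<open>Boundedness is inherited because the quotient quasi-norm of [x] is at most p(x). For
  \<open>g\<close> in \<open>G\<^sub>Y\<close> the class [g] equals [0], where \<open>h\<close>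
  vanishes.\<close>

lemma pull_back_in_polar:
  assumes h: "h \<in> carrier (dual_cone Q (quotient_norm p))"
  shows "pull_back h \<in> polar X p Y"
proof -
  have h_add: "h (coset X Y (x \<otimes> z)) = h (coset X Y x) + h (coset X Y z)"
    if "x \<in> carrier X" "z \<in> carrier X" for x z
    using h that unfolding Q.dual_cone_carrier_iff
    by (auto simp: quotient_carrier quotient_add[OF sub])
  have h_scale: "h (coset X Y (r \<odot> x)) = r * h (coset X Y x)"
    if "x \<in> carrier X" "0 \<le> r" for x r
    using h that unfolding Q.dual_cone_carrier_iff
    by (auto simp: quotient_carrier quotient_scale[OF sub])
  have h_one: "h (coset X Y \<one>) = 0" using h_add[of \<one> \<one>] by simp
  have "h (coset X Y x) \<le> dual_norm Q (quotient_norm p) h * p x" if x: "x \<in> carrier X" for x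
  proof -
    have "h (coset X Y x) \<le> dual_norm Q (quotient_norm p) h * quotient_norm p (coset X Y x)"
      using x by (intro Q.le_dual_norm_mult[OF h]) (auto simp: quotient_carrier)
    also have "\<dots> \<le> dual_norm Q (quotient_norm p) h * p x"
      by (intro mult_left_mono quotient_norm_le_self[OF x] Q.dual_norm_nonneg[OF h])
    finally show ?thesis .
  qed
  then have "\<exists>C\<ge>0. \<forall>x\<in>carrier X. h (coset X Y x) \<le> C * p x"
    using Q.dual_norm_nonneg[OF h] by blast
  then have "pull_back h \<in> carrier (dual_cone X p)"
    unfolding dual_cone_carrier_iff by (auto simp: pull_back_def h_add h_scale)
  moreover have "pull_back h g = 0" if g: "g \<in> invertibles X Y" for g
    using coset_shift[OF sub one_closed g] invertibles_carrier[OF sub g]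
    by (simp add: pull_back_def h_one)
  ultimately show ?thesis by (simp add: polar_def)
qed

lemma polar_isometric_dual_quotient:
  "isometrically_isomorphic
     ((dual_cone X p)\<lparr>carrier := polar X p Y\<rparr>) (dual_norm X p)
     (dual_cone Q (quotient_norm p)) (dual_norm Q (quotient_norm p))"
proof -
  let ?P = "(dual_cone X p)\<lparr>carrier := polar X p Y\<rparr>"
  let ?D = "dual_cone Q (quotient_norm p)"
  have P: "quasi_normed_cone ?P (dual_norm X p)"
    by (rule quasi_normed_subcone[OF quasi_normed_dual subcone_polar])
  interpret P: quasi_normed_cone ?P "dual_norm X p" by (fact P)
  have D: "quasi_normed_cone ?D (dual_norm Q (quotient_norm p))" by (rule Q.quasi_normed_dual)
  \<comment> \<open>\<open>descend_coset\<close> evaluates sums and multiples only once these are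
    known to lie in the polar, which the cone structure of \<open>?P\<close> supplies.\<close>
  have closure: "(\<lambda>x\<in>carrier X. f x + g x) \<in> polar X p Y" "(\<lambda>x\<in>carrier X. r * f x) \<in> polar X p Y"
    if "f \<in> polar X p Y" "g \<in> polar X p Y" "0 \<le> r" for f g r
    using P.m_closed[of f g] P.scale_closed[of r f] that by (simp_all add: dual_cone_simps)
  have "descend (\<lambda>x\<in>carrier X. f x + g x) = (\<lambda>A\<in>carrier Q. descend f A + descend g A)"
    if "f \<in> polar X p Y" "g \<in> polar X p Y" for f g
    \<comment> \<open>The scalar 0 merely fills the premise on \<open>r\<close> shared by the two
      closure facts.\<close>
    using that closure(1)[OF that, of 0]
    by (intro extensionalityI[of _ "carrier Q"])
      (auto simp: quotient_carrier descend_coset descend_extensional[unfolded quotient_carrier])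
  moreover have "descend (\<lambda>x\<in>carrier X. r * f x) = (\<lambda>A\<in>carrier Q. r * descend f A)"
    if "f \<in> polar X p Y" "0 \<le> r" for f r
    using that closure(2)[OF that(1) that(1) that(2)]
    by (intro extensionalityI[of _ "carrier Q"])
      (auto simp: quotient_carrier descend_coset descend_extensional[unfolded quotient_carrier])
  ultimately have lin: "linear_map ?P ?D descend"
    unfolding linear_map_iff[OF P.rcone_axioms Q.rcone_dual]
    by (auto simp: dual_cone_simps Q.dual_cone_simps descend_in_dual)
  show ?thesis
  proof (rule isometrically_isomorphicI[OF P D lin, of pull_back])
    show "pull_back \<in> carrier ?D \<rightarrow> carrier ?P" using pull_back_in_polar by auto
    show "pull_back (descend f) = f" if "f \<in> carrier ?P" for f
      using that by (intro extensionalityI[of _ "carrier X"])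
        (auto simp: pull_back_def descend_coset polar_def dual_extensional)
    show "descend (pull_back h) = h" if h: "h \<in> carrier ?D" for h
    proof (rule extensionalityI[of _ "carrier Q"])
      show "descend (pull_back h) A = h A" if "A \<in> carrier Q" for A
        using that descend_coset[OF pull_back_in_polar[OF h]]
        by (auto simp: quotient_carrier pull_back_def)
    qed (auto simp: descend_extensional Q.dual_extensional[OF h])
    show "dual_norm Q (quotient_norm p) (descend f) = dual_norm X p f" if "f \<in> carrier ?P" for f
      using that dual_norm_descend by simp
  qed
qed

end

end

theorem proposition33:
  fixes X :: "'a rcone" and p :: "'a \<Rightarrow> real" and Y :: "'a set"
  assumes "quasi_normed_cone X p"
    and "subcone Y X"
    and "qtopology X p closure_of invertibles X Y = invertibles X Y"
  shows "subcone (polar X p Y) (dual_cone X p) \<and>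
    isometrically_isomorphic
      ((dual_cone X p)\<lparr>carrier := polar X p Y\<rparr>) (dual_norm X p)
      (dual_cone (quotient_cone X Y) (quotient_norm p))
      (dual_norm (quotient_cone X Y) (quotient_norm p))"
  using quasi_normed_cone.subcone_polar polar_isometric_dual_quotient assms by blast

end
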